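(* Let $C^{ijkl}$ be an elasticity tensor in three dimensions, $\rho>0$ the mass density, and $n$ a unit vector such that the Christoffel matrix $\Gamma^{il}=\frac1\rho C^{ijkl}n_jn_k$ is positive definite. Then all three purely polarized waves (one longitudinal and two linearly independent transverse ones) can propagate in the direction $n$ if and only if $$S^i=S\,n^i\quad\text{for all } i,$$ where $S^i:=\Gamma^{ij}n_j$ and $S:=\Gamma^{ij}n_in_j$ (equivalently $S^i=\frac1\rho C^{(ijkl)}n_jn_kn_l$ and $S=\frac1\rho C^{(ijkl)}n_in_jn_kn_l$).
   Context: Indices run over $1,2,3$; summation over repeated indices; Cartesian coordinates, $g^{ij}=\mathrm{diag}(1,1,1)$, so $n^i=n_i$. An elasticity tensor is a real fourth-rank tensor $C^{ijkl}$ on $\mathbb R^3$ with $C^{ijkl}=C^{jikl}$, $C^{ijkl}=C^{ijlk}$ (minor symmetries) and $C^{ijkl}=C^{klij}$ (major symmetry). $C^{(ijkl)}$ is $\frac1{4!}$ times the sum over all permutations of the indices. A wave propagating in direction $n$ with phase velocity $v>0$ and polarization $U\neq0$ is a solution of $(v^2g^{il}-\Gamma^{il})U_l=0$. It is longitudinal if $U$ is parallel to $n$ and transverse if $U\cdot n=0$. *)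

theory Defs
  imports "HOL-Analysis.Analysis" "HOL-Combinatorics.Permutations"
begin

text \<open>Cartesian coordinates are used throughout, so upper and lower indices are identified.\<close>

type_synonym tensor4 = "real ^ 3 ^ 3 ^ 3 ^ 3"

definition elasticity_tensor :: "tensor4 \<Rightarrow> bool" where
  "elasticity_tensor C \<longleftrightarrow>
     (\<forall>i j k l. C $ i $ j $ k $ l = C $ j $ i $ k $ l) \<and>
     (\<forall>i j k l. C $ i $ j $ k $ l = C $ i $ j $ l $ k) \<and>
     (\<forall>i j k l. C $ i $ j $ k $ l = C $ k $ l $ i $ j)"

text \<open>The permutations act on the four index slots, numbered from 0.\<close>

definition symmetrization :: "tensor4 \<Rightarrow> tensor4" where
  "symmetrization C = (\<chi> i j k l.
     (1 / fact 4) * (\<Sum>p | p permutes {..<4::nat}.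
        C $ ([i, j, k, l] ! p 0) $ ([i, j, k, l] ! p 1)
          $ ([i, j, k, l] ! p 2) $ ([i, j, k, l] ! p 3)))"

definition christoffel :: "real \<Rightarrow> tensor4 \<Rightarrow> real ^ 3 \<Rightarrow> real ^ 3 ^ 3" where
  "christoffel \<rho> C n =
     (\<chi> i l. (1 / \<rho>) * (\<Sum>j\<in>UNIV. \<Sum>k\<in>UNIV. C $ i $ j $ k $ l * n $ j * n $ k))"

text \<open>Symmetry is not part of this definition: the Christoffel matrix of an elasticity
  tensor is always symmetric.\<close>

definition positive_definite :: "real ^ 'n ^ 'n \<Rightarrow> bool" where
  "positive_definite A \<longleftrightarrow> (\<forall>x. x \<noteq> 0 \<longrightarrow> x \<bullet> (A *v x) > 0)"

definition is_wave :: "real \<Rightarrow> tensor4 \<Rightarrow> real ^ 3 \<Rightarrow> real \<Rightarrow> real ^ 3 \<Rightarrow> bool" where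
  "is_wave \<rho> C n v U \<longleftrightarrow>
     v > 0 \<and> U \<noteq> 0 \<and> (v\<^sup>2 *\<^sub>R mat 1 - christoffel \<rho> C n) *v U = 0"

definition longitudinal :: "real ^ 3 \<Rightarrow> real ^ 3 \<Rightarrow> bool" where
  "longitudinal n U \<longleftrightarrow> (\<exists>c. U = c *\<^sub>R n)"

definition transverse :: "real ^ 3 \<Rightarrow> real ^ 3 \<Rightarrow> bool" where
  "transverse n U \<longleftrightarrow> U \<bullet> n = 0"

text \<open>The phase velocities of the three waves are independent of each other. The condition
  \<open>U1 \<noteq> U2\<close> is needed because \<open>{U1, U2}\<close> collapses to a singleton otherwise.\<close>

definition all_pure_waves :: "real \<Rightarrow> tensor4 \<Rightarrow> real ^ 3 \<Rightarrow> bool" where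
  "all_pure_waves \<rho> C n \<longleftrightarrow>
     (\<exists>v U. is_wave \<rho> C n v U \<and> longitudinal n U) \<and>
     (\<exists>v1 U1 v2 U2.
        is_wave \<rho> C n v1 U1 \<and> transverse n U1 \<and>
        is_wave \<rho> C n v2 U2 \<and> transverse n U2 \<and>
        U1 \<noteq> U2 \<and> independent {U1, U2})"

definition S_vec :: "real \<Rightarrow> tensor4 \<Rightarrow> real ^ 3 \<Rightarrow> real ^ 3" where
  "S_vec \<rho> C n = (\<chi> i. \<Sum>j\<in>UNIV. christoffel \<rho> C n $ i $ j * n $ j)"

definition S_scalar :: "real \<Rightarrow> tensor4 \<Rightarrow> real ^ 3 \<Rightarrow> real" where
  "S_scalar \<rho> C n = (\<Sum>i\<in>UNIV. \<Sum>j\<in>UNIV. christoffel \<rho> C n $ i $ j * n $ i * n $ j)"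

end

theory Submission
  imports Defs
begin

text \<open>
  A longitudinal wave exists precisely when \<open>n\<close> is an eigenvector of the Christoffel matrix, which
  is the condition on \<open>S_vec\<close>. By the symmetry of the Christoffel matrix, the plane orthogonal to
  \<open>n\<close> is then invariant, hence is spanned by two orthogonal eigenvectors, and positive definiteness
  turns all eigenvalues into squared velocities. An eigenvector in an invariant subspace is found
  by maximising the quadratic form on the unit sphere of the subspace.
\<close>

section \<open>Eigenvectors of symmetric matrices orthogonal to given eigenvectors\<close>

lemma inner_matrix_vector_symmetric:
  fixes A :: "real ^ 'n ^ 'n"
  assumes "transpose A = A"
  shows "x \<bullet> (A *v y) = (A *v x) \<bullet> y"
  by (metis assms dot_lmul_matrix vector_transpose_matrix)

text \<open>Invariance keeps the residual \<open>A *v x - m *\<^sub>R x\<close> of a maximiser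
  \<open>x\<close> inside \<open>V\<close>, so moving along it is an admissible variation. Its
  first-order gain would be positive unless the residual vanishes.\<close>

lemma symmetric_eigenvector_in_subspace:
  fixes A :: "real ^ 'n ^ 'n"
  assumes sym: "transpose A = A" and V: "subspace V" "V \<noteq> {0}"
    and inv: "\<And>x. x \<in> V \<Longrightarrow> A *v x \<in> V"
  obtains m x where "x \<in> V" "x \<noteq> 0" "A *v x = m *\<^sub>R x"
proof -
  let ?K = "sphere 0 1 \<inter> V"
  have "compact ?K"
    by (simp add: V(1) closed_subspace compact_Int_closed)
  moreover have "?K \<noteq> {}"
  proof -
    obtain y where "y \<in> V" "y \<noteq> 0"
      using V subspace_0 by blast
    then have "(1 / norm y) *\<^sub>R y \<in> ?K"
      using V(1) by (simp add: subspace_scale)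
    then show ?thesis by blast
  qed
  moreover have "continuous_on ?K (\<lambda>x. x \<bullet> (A *v x))"
    by (intro continuous_intros matrix_vector_mult_linear_continuous_on)
  ultimately obtain x where x: "x \<in> ?K" and mx: "\<And>y. y \<in> ?K \<Longrightarrow> y \<bullet> (A *v y) \<le> x \<bullet> (A *v x)"
    using continuous_attains_sup[of ?K "\<lambda>x. x \<bullet> (A *v x)"] by blast
  define m where "m = x \<bullet> (A *v x)"
  \<comment> \<open>Both sides are homogeneous of degree two, so the bound on the unit sphere
    extends to all of \<open>V\<close>.\<close>
  have le: "y \<bullet> (A *v y) \<le> m * (y \<bullet> y)" if "y \<in> V" for y
  proof (cases "y = 0")
    case False
    define u where "u = (1 / norm y) *\<^sub>R y"
    have "u \<in> ?K"
      using False that V(1) by (simp add: u_def subspace_scale)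
    then have "u \<bullet> (A *v u) \<le> m"
      using mx m_def by simp
    moreover have "y = norm y *\<^sub>R u"
      using False by (simp add: u_def)
    then have "y \<bullet> (A *v y) = (norm y)\<^sup>2 * (u \<bullet> (A *v u))"
      by (metis inner_scaleR_left inner_scaleR_right matrix_vector_mult_scaleR mult.assoc
          power2_eq_square)
    ultimately show ?thesis
      by (simp add: power2_norm_eq_inner[symmetric] mult.commute[of m] mult_left_mono)
  qed simp
  define z where "z = A *v x - m *\<^sub>R x"
  have xV: "x \<in> V"
    using x by simp
  have xx: "x \<bullet> x = 1"
    using x by (simp add: dot_square_norm)
  have zV: "z \<in> V"
    using xV V(1) inv by (simp add: z_def subspace_diff subspace_scale)
  define k where "k = z \<bullet> (A *v z) - m * (z \<bullet> z)"
  \<comment> \<open>Perturbing the maximiser in the direction of the residual \<open>z\<close>.\<close>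
  have quad: "2 * t * (z \<bullet> z) + t\<^sup>2 * k \<le> 0" for t
  proof -
    have "(x + t *\<^sub>R z) \<bullet> (A *v (x + t *\<^sub>R z)) \<le> m * ((x + t *\<^sub>R z) \<bullet> (x + t *\<^sub>R z))"
      using xV zV V(1) by (intro le) (simp add: subspace_add subspace_scale)
    \<comment> \<open>By symmetry the two cross terms add up to
      \<open>2 * t * (z \<bullet> (A *v x))\<close>; the part with
      \<open>m * (z \<bullet> x)\<close> cancels against the right-hand side.\<close>
    moreover have "z \<bullet> (A *v x) = z \<bullet> z + m * (z \<bullet> x)"
      by (simp add: z_def inner_diff_right)
    moreover have "x \<bullet> (A *v z) = z \<bullet> (A *v x)"
      by (metis inner_commute inner_matrix_vector_symmetric sym)
    ultimately show ?thesis
      using xx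
      by (simp add: k_def matrix_vector_right_distrib matrix_vector_mult_scaleR inner_add_left
          inner_add_right m_def[symmetric] power2_eq_square algebra_simps inner_commute)
  qed
  have "z = 0"
  proof (rule ccontr)
    assume "z \<noteq> 0"
    then have p: "z \<bullet> z > 0" by simp
    \<comment> \<open>This \<open>t\<close> is small enough that \<open>t * k\<close> is at most
      \<open>z \<bullet> z\<close> in absolute value, so the linear term wins; the summand 1 covers
      \<open>k = 0\<close>.\<close>
    define t where "t = (z \<bullet> z) / (\<bar>k\<bar> + 1)"
    have t: "t > 0" using p by (simp add: t_def)
    have "t * (2 * (z \<bullet> z) + t * k) \<le> 0"
      using quad[of t] by (simp add: power2_eq_square algebra_simps)
    then have "2 * (z \<bullet> z) + t * k \<le> 0"
      using t by (simp add: mult_le_0_iff)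
    moreover have "\<bar>t * k\<bar> \<le> t * (\<bar>k\<bar> + 1)"
      using t by (simp add: abs_mult)
    moreover have "t * (\<bar>k\<bar> + 1) = z \<bullet> z"
      by (simp add: t_def)
    ultimately show False using p by linarith
  qed
  then show ?thesis
    using that[of x m] xV xx z_def by fastforce
qed

text \<open>Two vectors span at most a plane. They may be dependent or equal, where a cross product
  would vanish.\<close>

lemma ex_nonzero_orthogonal_3:
  fixes a b :: "real ^ 3"
  shows "\<exists>z. z \<noteq> 0 \<and> z \<bullet> a = 0 \<and> z \<bullet> b = 0"
proof -
  have "card {a, b} < DIM(real ^ 3)"
    by (simp add: card_insert_if)
  then have "dim {a, b} < DIM(real ^ 3)"
    using dim_le_card'[of "{a, b}"] by simp
  then obtain z where "z \<noteq> 0" "\<And>y. y \<in> span {a, b} \<Longrightarrow> orthogonal z y"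
    using orthogonal_to_subspace_exists by metis
  then show ?thesis
    by (metis insertCI orthogonal_def span_base)
qed

text \<open>If \<open>x\<close> is orthogonal to an eigenvector \<open>a\<close>, then by symmetry
  \<open>(A *v x) \<bullet> a = x \<bullet> (A *v a) = r * (x \<bullet> a) = 0\<close>, so the
  orthogonal complement is invariant.\<close>

lemma symmetric_eigenvector_orthogonal:
  fixes A :: "real ^ 3 ^ 3"
  assumes "transpose A = A" and "A *v a = r *\<^sub>R a" and "A *v b = s *\<^sub>R b"
  obtains m x where "x \<noteq> 0" "x \<bullet> a = 0" "x \<bullet> b = 0" "A *v x = m *\<^sub>R x"
proof -
  let ?V = "{x. x \<bullet> a = 0 \<and> x \<bullet> b = 0}"
  have "subspace ?V"
    by (auto simp: subspace_def inner_add_left)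
  moreover have "?V \<noteq> {0}"
    using ex_nonzero_orthogonal_3[of a b] by auto
  moreover have "A *v x \<in> ?V" if "x \<in> ?V" for x
    using that assms inner_matrix_vector_symmetric[OF assms(1), of x, symmetric] by simp
  ultimately obtain m x where "x \<in> ?V" "x \<noteq> 0" "A *v x = m *\<^sub>R x"
    by (rule symmetric_eigenvector_in_subspace[OF assms(1)])
  then show ?thesis
    using that by blast
qed

section \<open>The Christoffel matrix and pure waves\<close>

lemma transpose_christoffel:
  assumes "elasticity_tensor C"
  shows "transpose (christoffel \<rho> C n) = christoffel \<rho> C n"
proof -
  \<comment> \<open>Major symmetry followed by both minor ones. This also exchanges \<open>j\<close>
    and \<open>k\<close>, which swapping the two sums undoes.\<close>
  have C: "C $ l $ j $ k $ i = C $ i $ k $ j $ l" for i j k l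
    using assms unfolding elasticity_tensor_def by metis
  have "(\<Sum>j\<in>UNIV. \<Sum>k\<in>UNIV. C $ l $ j $ k $ i * n $ j * n $ k)
      = (\<Sum>j\<in>UNIV. \<Sum>k\<in>UNIV. C $ i $ j $ k $ l * n $ j * n $ k)" for i l
    unfolding C[of i _ _ l] by (subst sum.swap) (simp add: mult_ac)
  then show ?thesis
    by (simp add: christoffel_def transpose_def vec_eq_iff)
qed

lemma is_wave_iff:
  "is_wave \<rho> C n v U \<longleftrightarrow> v > 0 \<and> U \<noteq> 0 \<and> christoffel \<rho> C n *v U = v\<^sup>2 *\<^sub>R U"
  unfolding is_wave_def
  by (auto simp: matrix_vector_mult_diff_rdistrib scaleR_matrix_vector_assoc[symmetric])

lemma is_wave_sqrt_eigenvalue: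
  assumes "positive_definite (christoffel \<rho> C n)"
    and "U \<noteq> 0" and "christoffel \<rho> C n *v U = m *\<^sub>R U"
  shows "is_wave \<rho> C n (sqrt m) U"
proof -
  \<comment> \<open>Positive definiteness is tested on the eigenvector itself.\<close>
  have "0 < m * (U \<bullet> U)"
    using assms unfolding positive_definite_def by (metis inner_scaleR_right)
  then have "m > 0"
    by (metis zero_less_mult_pos2 assms(2) inner_gt_zero_iff)
  then show ?thesis
    using assms by (simp add: is_wave_iff)
qed

lemma S_vec_eq: "S_vec \<rho> C n = christoffel \<rho> C n *v n"
  by (simp add: S_vec_def matrix_vector_mult_def vec_eq_iff)

lemma S_scalar_eq: "S_scalar \<rho> C n = n \<bullet> S_vec \<rho> C n"
  by (simp add: S_scalar_def S_vec_def inner_vec_def sum_distrib_left mult_ac)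

lemma all_pure_waves_iff_eigenvector:
  assumes C: "elasticity_tensor C" and n: "n \<noteq> 0"
    and pd: "positive_definite (christoffel \<rho> C n)"
  shows "all_pure_waves \<rho> C n \<longleftrightarrow> (\<exists>m. christoffel \<rho> C n *v n = m *\<^sub>R n)"
    (is "_ \<longleftrightarrow> (\<exists>m. ?G *v n = m *\<^sub>R n)")
proof
  assume "all_pure_waves \<rho> C n"
  then obtain v c where "c *\<^sub>R n \<noteq> 0" "?G *v (c *\<^sub>R n) = v\<^sup>2 *\<^sub>R c *\<^sub>R n"
    unfolding all_pure_waves_def longitudinal_def is_wave_iff by blast
  then have "c *\<^sub>R (?G *v n) = c *\<^sub>R (v\<^sup>2 *\<^sub>R n)" "c \<noteq> 0"
    by (auto simp: matrix_vector_mult_scaleR)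
  then show "\<exists>m. ?G *v n = m *\<^sub>R n"
    by (metis scaleR_cancel_left)
next
  assume "\<exists>m. ?G *v n = m *\<^sub>R n"
  then obtain m where m: "?G *v n = m *\<^sub>R n" ..
  note sym = transpose_christoffel[OF C, of \<rho> n]
  \<comment> \<open>Only orthogonality to \<open>n\<close> is wanted here, so \<open>n\<close> fills
    both eigenvector slots; the next call adds \<open>U1\<close>, which makes the two polarizations
    orthogonal and hence independent.\<close>
  obtain m1 U1 where U1: "U1 \<noteq> 0" "U1 \<bullet> n = 0" "?G *v U1 = m1 *\<^sub>R U1"
    using symmetric_eigenvector_orthogonal[OF sym m m] by metis
  obtain m2 U2 where U2: "U2 \<noteq> 0" "U2 \<bullet> n = 0" "U2 \<bullet> U1 = 0" "?G *v U2 = m2 *\<^sub>R U2"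
    using symmetric_eigenvector_orthogonal[OF sym m U1(3)] by metis
  have "U1 \<noteq> U2" using U1 U2 by auto
  moreover have "independent {U1, U2}"
    using U1 U2 by (intro pairwise_orthogonal_independent)
      (auto simp: pairwise_def orthogonal_def inner_commute)
  moreover have "longitudinal n n"
    unfolding longitudinal_def by (metis scaleR_one)
  ultimately show "all_pure_waves \<rho> C n"
    unfolding all_pure_waves_def transverse_def
    using is_wave_sqrt_eigenvalue[OF pd] n m U1 U2 by metis
qed

section \<open>Contractions of the totally symmetrized tensor\<close>

lemma permutes_lessThan_4_cases:
  assumes "p permutes {..<4::nat}"
  shows "(p 0, p 1, p 2, p 3) \<in>
    {(0,1,2,3), (0,1,3,2), (0,2,1,3), (0,2,3,1), (0,3,1,2), (0,3,2,1),
     (1,0,2,3), (1,0,3,2), (1,2,0,3), (1,2,3,0), (1,3,0,2), (1,3,2,0),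
     (2,0,1,3), (2,0,3,1), (2,1,0,3), (2,1,3,0), (2,3,0,1), (2,3,1,0),
     (3,0,1,2), (3,0,2,1), (3,1,0,2), (3,1,2,0), (3,2,0,1), (3,2,1,0)}"
proof -
  have ran: "p m = 0 \<or> p m = 1 \<or> p m = 2 \<or> p m = 3" if "m < 4" for m
  proof -
    have "p m < 4"
      using permutes_in_image[OF assms, of m] that by simp
    then show ?thesis by linarith
  qed
  have neq: "p a \<noteq> p b" if "a \<noteq> b" for a b
    using permutes_inj[OF assms] that by (simp add: inj_eq)
  have pair: "(p a, p b) \<in> {(0,1), (0,2), (0,3), (1,0), (1,2), (1,3),
      (2,0), (2,1), (2,3), (3,0), (3,1), (3,2)}" if "a < 4" "b < 4" "a \<noteq> b" for a b
    using ran[OF that(1)] ran[OF that(2)] neq[OF that(3)] by auto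
  have "(p 0, p 1) \<in> {(0,1), (0,2), (0,3), (1,0), (1,2), (1,3),
      (2,0), (2,1), (2,3), (3,0), (3,1), (3,2)}"
    by (rule pair) simp_all
  moreover have "(p 2, p 3) \<in> {(0,1), (0,2), (0,3), (1,0), (1,2), (1,3),
      (2,0), (2,1), (2,3), (3,0), (3,1), (3,2)}"
    by (rule pair) simp_all
  moreover have "p 0 \<noteq> p 2" "p 0 \<noteq> p 3" "p 1 \<noteq> p 2" "p 1 \<noteq> p 3"
    by (simp_all add: neq)
  \<comment> \<open>Of the 144 combinations of the two pairs, the four inequalities leave the 24
    with disjoint pairs.\<close>
  ultimately show ?thesis
    by (simp only: insert_iff empty_iff prod.inject simp_thms) (elim disjE; elim conjE; simp)
qed

text \<open>The weight is symmetric in the three indices, so these are renamings of summation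
  indices. The two adjacent transpositions generate the others.\<close>

lemma sum_triple_permute:
  fixes f :: "'a :: finite \<Rightarrow> 'a \<Rightarrow> 'a \<Rightarrow> 'b :: comm_semiring_0" and w :: "'a \<Rightarrow> 'b"
  defines "S \<equiv> (\<lambda>g. \<Sum>j\<in>UNIV. \<Sum>k\<in>UNIV. \<Sum>l\<in>UNIV. g j k l * w j * w k * w l)"
  shows "S (\<lambda>j k l. f j l k) = S f"
    and "S (\<lambda>j k l. f k j l) = S f"
    and "S (\<lambda>j k l. f k l j) = S f"
    and "S (\<lambda>j k l. f l j k) = S f"
    and "S (\<lambda>j k l. f l k j) = S f"
proof -
  have 1: "S (\<lambda>j k l. g j l k) = S g" for g
    unfolding S_def by (rule sum.cong[OF refl], rule trans[OF sum.swap], simp add: mult_ac)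
  have 2: "S (\<lambda>j k l. g k j l) = S g" for g
    unfolding S_def by (subst sum.swap) (simp add: mult_ac)
  show "S (\<lambda>j k l. f j l k) = S f" "S (\<lambda>j k l. f k j l) = S f"
    by (rule 1 2)+
  show 3: "S (\<lambda>j k l. f k l j) = S f"
    by (rule trans[OF 2[of "\<lambda>j k l. f j l k"] 1])
  show "S (\<lambda>j k l. f l j k) = S f"
    by (rule trans[OF 1[of "\<lambda>j k l. f k j l"] 2])
  show "S (\<lambda>j k l. f l k j) = S f"
    by (rule trans[OF 1[of "\<lambda>j k l. f k l j"] 3])
qed

text \<open>Each of the 24 permuted copies of \<open>C\<close> has the same contraction, and hence
  so does their average.\<close>

lemma symmetrization_contract:
  assumes "elasticity_tensor C"
  shows "(\<Sum>j\<in>UNIV. \<Sum>k\<in>UNIV. \<Sum>l\<in>UNIV. symmetrization C $ i $ j $ k $ l * n $ j * n $ k * n $ l)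
    = (\<Sum>j\<in>UNIV. \<Sum>k\<in>UNIV. \<Sum>l\<in>UNIV. C $ i $ j $ k $ l * n $ j * n $ k * n $ l)"
proof -
  let ?P = "{p. p permutes {..<4::nat}}"
  define D where "D = (\<lambda>p j k l. C $ ([i, j, k, l] ! p 0) $ ([i, j, k, l] ! p 1)
          $ ([i, j, k, l] ! p 2) $ ([i, j, k, l] ! p (3::nat)))"
  define S where "S = (\<lambda>g. \<Sum>j\<in>UNIV. \<Sum>k\<in>UNIV. \<Sum>l\<in>UNIV. g j k l * n $ j * n $ k * n $ l)"
  note perm = sum_triple_permute[where w = "\<lambda>j. n $ j"]
  have minor1: "C $ a $ b $ c $ d = C $ b $ a $ c $ d"
    and minor2: "C $ a $ b $ c $ d = C $ a $ b $ d $ c"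
    and major: "C $ a $ b $ c $ d = C $ c $ d $ a $ b" for a b c d
    using assms unfolding elasticity_tensor_def by blast+
  \<comment> \<open>The symmetries move the free index \<open>i\<close> to the first slot; the remaining indices are all
    contracted with \<open>n\<close> and can be renamed.\<close>
  have i_2: "C $ a $ i $ c $ d = C $ i $ a $ c $ d"
    and i_3: "C $ a $ b $ i $ d = C $ i $ d $ a $ b"
    and i_4: "C $ a $ b $ c $ i = C $ i $ c $ a $ b" for a b c d
    by (metis minor1, metis minor2 major, metis minor2 major)
  have D: "S (D p) = S (\<lambda>j k l. C $ i $ j $ k $ l)" if "p permutes {..<4}" for p
  proof -
    let ?T = "\<lambda>j k l. C $ i $ j $ k $ l"
    \<comment> \<open>Once \<open>i\<close> stands first, the other three indices follow in one of
      their six orders.\<close>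
    have "D p = ?T \<or> D p = (\<lambda>j k l. ?T j l k) \<or> D p = (\<lambda>j k l. ?T k j l) \<or>
        D p = (\<lambda>j k l. ?T k l j) \<or> D p = (\<lambda>j k l. ?T l j k) \<or> D p = (\<lambda>j k l. ?T l k j)"
      using permutes_lessThan_4_cases[OF that] unfolding D_def
      by (elim insertE emptyE; simp only: prod.inject; elim conjE;
          simp add: i_2 i_3 i_4)
    then show ?thesis
      using perm[of ?T] by (elim disjE) (simp_all add: S_def)
  qed
  have "(\<Sum>j\<in>UNIV. \<Sum>k\<in>UNIV. \<Sum>l\<in>UNIV. symmetrization C $ i $ j $ k $ l * n $ j * n $ k * n $ l)
      = (\<Sum>j\<in>UNIV. \<Sum>k\<in>UNIV. \<Sum>l\<in>UNIV. \<Sum>p\<in>?P. 1 / fact 4 * (D p j k l * n $ j * n $ k * n $ l))"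
    by (simp add: symmetrization_def D_def sum_distrib_left sum_distrib_right mult_ac)
  \<comment> \<open>The sum over permutations moves outwards past \<open>l\<close>, \<open>k\<close>
    and \<open>j\<close> in turn.\<close>
  also have "\<dots> = (\<Sum>j\<in>UNIV. \<Sum>k\<in>UNIV. \<Sum>p\<in>?P. \<Sum>l\<in>UNIV. 1 / fact 4 * (D p j k l * n $ j * n $ k * n $ l))"
    by (intro sum.cong refl sum.swap)
  also have "\<dots> = (\<Sum>j\<in>UNIV. \<Sum>p\<in>?P. \<Sum>k\<in>UNIV. \<Sum>l\<in>UNIV. 1 / fact 4 * (D p j k l * n $ j * n $ k * n $ l))"
    by (intro sum.cong refl sum.swap)
  also have "\<dots> = (\<Sum>p\<in>?P. 1 / fact 4 * S (D p))"
    by (subst sum.swap) (simp only: S_def sum_distrib_left)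
  also have "\<dots> = (\<Sum>p\<in>?P. 1 / fact 4 * S (\<lambda>j k l. C $ i $ j $ k $ l))"
    using D by simp
  also have "\<dots> = S (\<lambda>j k l. C $ i $ j $ k $ l)"
    \<comment> \<open>The number of equal summands cancels the factor
      \<open>1 / fact 4\<close>.\<close>
    using card_permutations[of "{..<4::nat}" 4] by simp
  finally show ?thesis by (simp only: S_def)
qed

lemma S_vec_symmetrization:
  assumes "elasticity_tensor C"
  shows "S_vec \<rho> C n $ i = (1 / \<rho>) * (\<Sum>j\<in>UNIV. \<Sum>k\<in>UNIV. \<Sum>l\<in>UNIV.
          symmetrization C $ i $ j $ k $ l * n $ j * n $ k * n $ l)"
proof -
  let ?t = "\<lambda>j k l. 1 / \<rho> * (C $ i $ j $ k $ l * n $ j * n $ k * n $ l)"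
  have "S_vec \<rho> C n $ i = (\<Sum>l\<in>UNIV. \<Sum>j\<in>UNIV. \<Sum>k\<in>UNIV. ?t j k l)"
    by (simp add: S_vec_def christoffel_def sum_distrib_left sum_distrib_right mult_ac)
  \<comment> \<open>The index \<open>l\<close> contracted in \<open>S_vec\<close> is summed
    outermost; two swaps bring it innermost.\<close>
  also have "\<dots> = (\<Sum>j\<in>UNIV. \<Sum>l\<in>UNIV. \<Sum>k\<in>UNIV. ?t j k l)"
    by (rule sum.swap)
  also have "\<dots> = (\<Sum>j\<in>UNIV. \<Sum>k\<in>UNIV. \<Sum>l\<in>UNIV. ?t j k l)"
    by (intro sum.cong refl sum.swap)
  finally show ?thesis
    unfolding symmetrization_contract[OF assms] by (simp only: sum_distrib_left)
qed

theorem proposition16: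
  fixes C :: tensor4 and \<rho> :: real and n :: "real ^ 3"
  assumes "elasticity_tensor C"
    and "\<rho> > 0"
    and "norm n = 1"
    and "positive_definite (christoffel \<rho> C n)"
  shows "(all_pure_waves \<rho> C n \<longleftrightarrow> (\<forall>i. S_vec \<rho> C n $ i = S_scalar \<rho> C n * n $ i)) \<and>
    (\<forall>i. S_vec \<rho> C n $ i =
       (1 / \<rho>) * (\<Sum>j\<in>UNIV. \<Sum>k\<in>UNIV. \<Sum>l\<in>UNIV.
          symmetrization C $ i $ j $ k $ l * n $ j * n $ k * n $ l)) \<and>
    S_scalar \<rho> C n =
       (1 / \<rho>) * (\<Sum>i\<in>UNIV. \<Sum>j\<in>UNIV. \<Sum>k\<in>UNIV. \<Sum>l\<in>UNIV.
          symmetrization C $ i $ j $ k $ l * n $ i * n $ j * n $ k * n $ l)"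
proof (intro conjI allI)
  have nn: "n \<bullet> n = 1"
    using assms(3) by (simp add: dot_square_norm)
  have "all_pure_waves \<rho> C n \<longleftrightarrow> (\<exists>m. S_vec \<rho> C n = m *\<^sub>R n)"
    using assms all_pure_waves_iff_eigenvector[of C n \<rho>] unfolding S_vec_eq by force
  \<comment> \<open>Taking the inner product with the unit vector \<open>n\<close> identifies
    \<open>m\<close> as \<open>S_scalar \<rho> C n\<close>.\<close>
  also have "\<dots> \<longleftrightarrow> S_vec \<rho> C n = S_scalar \<rho> C n *\<^sub>R n"
    unfolding S_scalar_eq using nn by auto
  finally show "all_pure_waves \<rho> C n \<longleftrightarrow> (\<forall>i. S_vec \<rho> C n $ i = S_scalar \<rho> C n * n $ i)"
    by (simp add: vec_eq_iff)
  show "S_vec \<rho> C n $ i = (1 / \<rho>) * (\<Sum>j\<in>UNIV. \<Sum>k\<in>UNIV. \<Sum>l\<in>UNIV.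
          symmetrization C $ i $ j $ k $ l * n $ j * n $ k * n $ l)" for i
    by (rule S_vec_symmetrization[OF assms(1)])
  show "S_scalar \<rho> C n = (1 / \<rho>) * (\<Sum>i\<in>UNIV. \<Sum>j\<in>UNIV. \<Sum>k\<in>UNIV. \<Sum>l\<in>UNIV.
          symmetrization C $ i $ j $ k $ l * n $ i * n $ j * n $ k * n $ l)"
    by (simp add: S_scalar_eq inner_vec_def S_vec_symmetrization[OF assms(1)]
        sum_distrib_left mult_ac)
qed

end
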